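(* For all $k\in\mathbb{N}$ and $p\in\mathbb{Z}$, $$\partial_t(\mu^p\,b^k)=b^k\left(\frac1\hbar\Bigl((\mu-\hbar)^p+(\mu+\hbar)^p-2\mu^p\Bigr)-\frac{(\mu-\hbar)^p-(\mu+\hbar)^p}{\mu}(k+1)\right),$$ $$Q(\mu^p\,b^k)=b^k\left(\Bigl((\mu-\hbar)^p+(\mu+\hbar)^p\Bigr)\frac k2+\frac{(\mu-\hbar)^p-(\mu+\hbar)^p}{\mu}\left(\frac{\hbar(k+1)}2-\frac{\mu^2}{2\hbar}\right)\right).$$
   Context: Fix $\hbar\ne0$. The complexified algebra $U(u(2)_\hbar)$ is generated by $x,y,z,t$ with $[x,y]=\hbar z$, $[y,z]=\hbar x$, $[z,x]=\hbar y$, and $t$ central. Put $b=-ix-y$ and $\mathrm{Cas}=x^2+y^2+z^2$. Partial derivatives $\partial_x,\partial_y,\partial_z$ and $\tilde\partial_t=\partial_t+\frac2\hbar$ commute with each other and satisfy the permutation relations $[\tilde\partial_t,t]=\frac\hbar2\tilde\partial_t$, $[\tilde\partial_t,x]=-\frac\hbar2\partial_x$, $[\tilde\partial_t,y]=-\frac\hbar2\partial_y$, $[\tilde\partial_t,z]=-\frac\hbar2\partial_z$; $[\partial_g,t]=\frac\hbar2\partial_g$ and $[\partial_g,g]=\frac\hbar2\tilde\partial_t$ for $g\in\{x,y,z\}$; $[\partial_x,y]=\frac\hbar2\partial_z$, $[\partial_x,z]=-\frac\hbar2\partial_y$, $[\partial_y,x]=-\frac\hbar2\partial_z$, $[\partial_y,z]=\frac\hbar2\partial_x$,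 $[\partial_z,x]=\frac\hbar2\partial_y$, $[\partial_z,y]=-\frac\hbar2\partial_x$. They act on $U(u(2)_\hbar)$ by moving derivatives to the right and evaluating on $1$: $\partial_x(1)=\partial_y(1)=\partial_z(1)=\partial_t(1)=0$, so $\tilde\partial_t(1)=\frac2\hbar$. Put $Q=x\partial_x+y\partial_y+z\partial_z$. The element $\mu$ is a central element, in an algebraic extension of the center, with $\mu^2=\hbar^2-4\,\mathrm{Cas}$ (it is the difference of the eigenvalues of the generating matrix of $U(u(2)_\hbar)$). Extension of the action to functions of $\mu$. From the permutation relations, $$\begin{pmatrix}\tilde\partial_t\\Q\end{pmatrix}\mathrm{Cas}=\Phi\begin{pmatrix}\tilde\partial_t\\Q\end{pmatrix},\qquad \Phi=\begin{pmatrix}\mathrm{Cas}-\frac34\hbar^2&-\hbar\\ \hbar\,\mathrm{Cas}&\mathrm{Cas}+\frac{\hbar^2}4\end{pmatrix}.$$ $\Phi$ has eigenvalues $\lambda_1=\frac\mu4(2\hbar-\mu)$, $\lambda_2=-\frac\mu4(2\hbar+\mu)$ and spectral projectors $P_1=\frac{\Phi-\lambda_2}{\lambda_1-\lambda_2}$, $P_2=\frac{\Phi-\lambda_1}{\lambda_2-\lambda_1}$. Hence $f(\mathrm{Cas})$ is moved through the column $(\tilde\partial_t,Q)^t$ by the matrix $f(\lambda_1)P_1+f(\lambda_2)P_2$. For $\mu^p=\bigl(\sqrt{\hbar^2-4\,\mathrm{Cas}}\bigr)^p$ the branches are fixed by $\sqrt{\hbar^2-4\lambda_1}=\mu-\hbar$,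 $\sqrt{\hbar^2-4\lambda_2}=\mu+\hbar$; that is, the action is defined by $$\begin{pmatrix}\tilde\partial_t\\Q\end{pmatrix}(\mu^pb^k)=\bigl((\mu-\hbar)^pP_1+(\mu+\hbar)^pP_2\bigr)\begin{pmatrix}\tilde\partial_t(b^k)\\Q(b^k)\end{pmatrix},$$ and $\partial_t=\tilde\partial_t-\frac2\hbar$. *)

theory Defs
  imports
    "HOL-Analysis.Cartesian_Space"
    "HOL-Library.Poly_Mapping"
    "HOL-Computational_Algebra.Polynomial_Factorial"
    "HOL-Computational_Algebra.Field_as_Ring"
    "HOL-Algebra.QuotRing"
begin

section \<open>Free associative algebras\<close>

text \<open>
  Words under concatenation, written additively, so that the convolution product on
  finitely supported functions makes \<open>gen list \<Rightarrow>\<^sub>0 'c\<close> the free associative unital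
  \<open>'c\<close>-algebra on the four generators.
\<close>

instantiation list :: (type) monoid_add
begin
definition zero_list :: "'a list" where "zero_list = []"
definition plus_list :: "'a list \<Rightarrow> 'a list \<Rightarrow> 'a list" where "plus_list = (@)"
instance by intro_classes (simp_all add: zero_list_def plus_list_def)
end

datatype gen = GX | GY | GZ | GT

type_synonym 'c falg = "gen list \<Rightarrow>\<^sub>0 'c"

definition scal :: "'c::field \<Rightarrow> 'c falg" where
  "scal c = Poly_Mapping.single [] c"

definition var :: "gen \<Rightarrow> 'c::field falg" where
  "var g = Poly_Mapping.single [g] 1"

definition falg_ring :: "'c::field falg ring" where
  "falg_ring = \<lparr>carrier = UNIV, mult = (*), one = 1, zero = 0, add = (+)\<rparr>"

definition Cas :: "'c::field falg" where
  "Cas = var GX ^ 2 + var GY ^ 2 + var GZ ^ 2"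

definition u2_relators :: "'c::field \<Rightarrow> 'c falg set" where
  "u2_relators h =
     {var GX * var GY - var GY * var GX - scal h * var GZ,
      var GY * var GZ - var GZ * var GY - scal h * var GX,
      var GZ * var GX - var GX * var GZ - scal h * var GY}
     \<union> {var GT * var g - var g * var GT |g. g \<in> {GX, GY, GZ}}"


section \<open>The partial derivatives\<close>

text \<open>\<open>DT\<close> stands for the shifted derivative \<open>\<partial>\<^sub>t + 2/h\<close>.\<close>

datatype der = DT | DX | DY | DZ

text \<open>\<open>perm h d g = (c, d')\<close> encodes the permutation relation \<open>[d, g] = c d'\<close>.\<close>

fun perm :: "'c::field \<Rightarrow> der \<Rightarrow> gen \<Rightarrow> 'c \<times> der" where
  "perm h DT GT = (h/2, DT)"
| "perm h DT GX = (-h/2, DX)"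
| "perm h DT GY = (-h/2, DY)"
| "perm h DT GZ = (-h/2, DZ)"
| "perm h DX GT = (h/2, DX)"
| "perm h DX GX = (h/2, DT)"
| "perm h DX GY = (h/2, DZ)"
| "perm h DX GZ = (-h/2, DY)"
| "perm h DY GT = (h/2, DY)"
| "perm h DY GX = (-h/2, DZ)"
| "perm h DY GY = (h/2, DT)"
| "perm h DY GZ = (h/2, DX)"
| "perm h DZ GT = (h/2, DZ)"
| "perm h DZ GX = (h/2, DY)"
| "perm h DZ GY = (-h/2, DX)"
| "perm h DZ GZ = (h/2, DT)"

text \<open>Derivatives of a word: move the derivative to the right, then evaluate it on 1.\<close>

fun word_der :: "'c::field \<Rightarrow> der \<Rightarrow> gen list \<Rightarrow> 'c falg" where
  "word_der h d [] = (if d = DT then scal (2/h) else 0)"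
| "word_der h d (g # w) =
     var g * word_der h d w + (case perm h d g of (c, d') \<Rightarrow> scal c * word_der h d' w)"

definition word_Q :: "'c::field \<Rightarrow> gen list \<Rightarrow> 'c falg" where
  "word_Q h w =
     var GX * word_der h DX w + var GY * word_der h DY w + var GZ * word_der h DZ w"


section \<open>Adjoining \<open>\<mu>\<close>\<close>

text \<open>
  Coefficients are rational functions of \<open>\<mu>\<close> over the complex numbers, so that negative powers
  of \<open>\<mu>\<close> and of its translates make sense.  Since the enveloping algebra is free over the
  polynomial ring in \<open>Cas\<close>, the quotient \<open>u2_mu h\<close> below, in which \<open>Cas\<close> is identified with
  \<open>(h\<^sup>2 - \<mu>\<^sup>2)/4\<close>, is its scalar extension from \<open>\<complex>[Cas]\<close> to \<open>\<complex>(\<mu>)\<close>.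
\<close>

type_synonym ratfun = "complex poly fract"

definition cnst :: "complex \<Rightarrow> ratfun" where
  "cnst c = Fract [:c:] 1"

definition mu :: ratfun where
  "mu = Fract [:0, 1:] 1"

text \<open>\<open>subst_mu c f\<close> is \<open>f(\<mu> + c)\<close>.\<close>

definition subst_mu :: "complex \<Rightarrow> ratfun \<Rightarrow> ratfun" where
  "subst_mu c f = (case quot_of_fract f of (p, q) \<Rightarrow> Fract (p \<circ>\<^sub>p [:c, 1:]) (q \<circ>\<^sub>p [:c, 1:]))"

lemma subst_mu_Fract:
  assumes "q \<noteq> 0"
  shows "subst_mu c (Fract p q) = Fract (p \<circ>\<^sub>p [:c, 1:]) (q \<circ>\<^sub>p [:c, 1:])"
proof -
  obtain p' q' where *: "quot_of_fract (Fract p q) = (p', q')" by force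
  then have q': "q' \<noteq> 0" by (metis snd_conv snd_quot_of_fract_nonzero)
  have "Fract p' q' = Fract p q"
    using * by (metis Fract_quot_of_fract fst_conv snd_conv)
  with assms q' have "p' * q = p * q'" by (simp add: eq_fract)
  then have "(p' \<circ>\<^sub>p [:c, 1:]) * (q \<circ>\<^sub>p [:c, 1:]) = (p \<circ>\<^sub>p [:c, 1:]) * (q' \<circ>\<^sub>p [:c, 1:])"
    by (simp flip: pcompose_mult)
  with assms q' show ?thesis
    unfolding subst_mu_def * case_prod_conv by (subst eq_fract) (auto simp: pcompose_eq_0_iff mult.commute)
qed

definition mu_relators :: "complex \<Rightarrow> ratfun falg set" where
  "mu_relators h =
     u2_relators (cnst h) \<union> {scal (mu^2) - (scal (cnst h ^ 2) - scal 4 * Cas)}"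

definition mu_ideal :: "complex \<Rightarrow> ratfun falg set" where
  "mu_ideal h = Idl\<^bsub>falg_ring\<^esub> mu_relators h"

definition u2_mu :: "complex \<Rightarrow> ratfun falg set ring" where
  "u2_mu h = falg_ring Quot mu_ideal h"

definition cls :: "complex \<Rightarrow> ratfun falg \<Rightarrow> ratfun falg set" where
  "cls h a = mu_ideal h +>\<^bsub>falg_ring\<^esub> a"

definition Phi :: "complex \<Rightarrow> ratfun falg^2^2" where
  "Phi h = vector
     [vector [Cas - scal (3/4 * cnst h ^ 2), - scal (cnst h)],
      vector [scal (cnst h) * Cas,           Cas + scal (cnst h ^ 2 / 4)]]"

definition lam1 :: "complex \<Rightarrow> ratfun" where
  "lam1 h = mu/4 * (2 * cnst h - mu)"

definition lam2 :: "complex \<Rightarrow> ratfun" where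
  "lam2 h = - mu/4 * (2 * cnst h + mu)"

definition P1 :: "complex \<Rightarrow> ratfun falg^2^2" where
  "P1 h = map_matrix ((*) (scal (1 / (lam1 h - lam2 h)))) (Phi h - mat (scal (lam2 h)))"

definition P2 :: "complex \<Rightarrow> ratfun falg^2^2" where
  "P2 h = map_matrix ((*) (scal (1 / (lam2 h - lam1 h)))) (Phi h - mat (scal (lam1 h)))"

text \<open>
  The matrix moving \<open>f(\<mu>)\<close> through the column \<open>(DT, Q)\<close>: the branches are chosen so that
  \<open>\<mu>\<close> becomes \<open>\<mu> - h\<close> on the first and \<open>\<mu> + h\<close> on the second spectral subspace.  A general
  element is a sum of terms \<open>f(\<mu>) w\<close> with \<open>w\<close> a word; \<open>DT_Q\<close> is the resulting additive map.
\<close>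

definition moved :: "complex \<Rightarrow> ratfun \<Rightarrow> ratfun falg^2^2" where
  "moved h f = map_matrix ((*) (scal (subst_mu (- h) f))) (P1 h)
             + map_matrix ((*) (scal (subst_mu h f))) (P2 h)"

definition DT_Q :: "complex \<Rightarrow> ratfun falg \<Rightarrow> ratfun falg^2" where
  "DT_Q h a = (\<Sum>w\<in>Poly_Mapping.keys a.
     moved h (Poly_Mapping.lookup a w)
       *v vector [word_der (cnst h) DT w, word_Q (cnst h) w])"

definition dtilde :: "complex \<Rightarrow> ratfun falg set \<Rightarrow> ratfun falg set" where
  "dtilde h X = the_elem ((\<lambda>a. cls h (DT_Q h a $ 1)) ` X)"

definition Q_op :: "complex \<Rightarrow> ratfun falg set \<Rightarrow> ratfun falg set" where
  "Q_op h X = the_elem ((\<lambda>a. cls h (DT_Q h a $ 2)) ` X)"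

definition d_t :: "complex \<Rightarrow> ratfun falg set \<Rightarrow> ratfun falg set" where
  "d_t h X = dtilde h X \<ominus>\<^bsub>u2_mu h\<^esub> cls h (scal (cnst (2/h))) \<otimes>\<^bsub>u2_mu h\<^esub> X"

definition b_elt :: "ratfun falg" where
  "b_elt = - scal (cnst \<i>) * var GX - var GY"

section \<open>Well-definedness\<close>

text \<open>
  The operators on words respect the relations, so \<open>dtilde\<close> and \<open>Q_op\<close> do not depend on the
  representative of a coset (\<open>dtilde_cls\<close>, \<open>Q_op_cls\<close>).
\<close>

lemma scal_0 [simp]: "scal 0 = 0" by (simp add: scal_def)
lemma scal_1 [simp]: "scal 1 = 1"
  by (simp add: scal_def flip: zero_list_def)
lemma scal_add: "scal (a + c) = scal a + scal c" by (simp add: scal_def single_add)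
lemma scal_uminus: "scal (- c) = - scal c" by (simp add: scal_def single_uminus)
lemma scal_diff: "scal (a - c) = scal a - scal c" by (simp add: scal_def single_diff)
lemma scal_mult: "scal (a * c) = scal a * scal c"
  by (simp add: scal_def mult_single plus_list_def)
lemma scal_power: "scal (a ^ n) = scal a ^ n"
  by (induction n) (simp_all add: scal_mult)
lemma single_conv: "Poly_Mapping.single w c = scal c * Poly_Mapping.single w 1"
  by (simp add: scal_def mult_single plus_list_def)
lemma single_Cons: "Poly_Mapping.single (g # w) c = var g * Poly_Mapping.single w c"
  by (simp add: var_def mult_single plus_list_def)
lemma single_Nil: "Poly_Mapping.single [] c = scal c"
  by (simp add: scal_def)

lemma falg_induct [case_names single add]:
  assumes "\<And>w c. P (Poly_Mapping.single w c)" "\<And>a b. P a \<Longrightarrow> P b \<Longrightarrow> P (a + b)"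
  shows "P (a :: 'c::field falg)"
proof -
  have "P (\<Sum>w\<in>A. Poly_Mapping.single w (Poly_Mapping.lookup a w))" if "finite A" for A
    using that by induction (use assms(1)[of _ 0] in \<open>simp_all add: assms\<close>)
  moreover have "(\<Sum>w\<in>Poly_Mapping.keys a. Poly_Mapping.single w (Poly_Mapping.lookup a w)) = a"
    by (rule poly_mapping_eqI) (simp add: lookup_sum lookup_single when_def in_keys_iff)
  ultimately show ?thesis by (metis finite_keys)
qed

lemma scal_comm: "a * scal c = scal c * (a::'c::field falg)"
  by (induction a rule: falg_induct)
    (simp_all add: scal_def mult_single plus_list_def mult.commute algebra_simps)

lemma scal_comm_var: "var g * scal c = scal c * var g" by (rule scal_comm)
lemma scal_left_comm: "var g * (scal c * a) = scal c * (var g * a)"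
  by (metis mult.assoc scal_comm)

definition hsum :: "('c::field \<Rightarrow> gen list \<Rightarrow> 'v::ab_group_add) \<Rightarrow> 'c falg \<Rightarrow> 'v" where
  "hsum F a = (\<Sum>w\<in>Poly_Mapping.keys a. F (Poly_Mapping.lookup a w) w)"

lemma hsum_single: "F 0 w = 0 \<Longrightarrow> hsum F (Poly_Mapping.single w c) = F c w"
  by (simp add: hsum_def)

lemma hsum_add:
  assumes "\<And>w. F 0 w = 0" "\<And>c d w. F (c + d) w = F c w + F d w"
  shows "hsum F (a + b) = hsum F a + hsum F b"
proof -
  let ?K = "Poly_Mapping.keys a \<union> Poly_Mapping.keys b"
  have *: "hsum F c = (\<Sum>w\<in>?K. F (Poly_Mapping.lookup c w) w)" if "Poly_Mapping.keys c \<subseteq> ?K" for c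
    unfolding hsum_def using that assms(1)
    by (intro sum.mono_neutral_left) (auto simp: in_keys_iff)
  show ?thesis
    by (subst (1 2 3) *) (auto simp: Poly_Mapping.keys_add lookup_add assms sum.distrib)
qed

text \<open>
  Linear extensions to the free algebra.  \<open>LD_var\<close> is the list of permutation relations as an
  operator identity, \<open>LD_G\<close> says that the derivatives descend to the enveloping algebra.
\<close>

definition LD :: "'c::field \<Rightarrow> der \<Rightarrow> 'c falg \<Rightarrow> 'c falg" where
  "LD h d = hsum (\<lambda>c w. scal c * word_der h d w)"

lemma LD_single: "LD h d (Poly_Mapping.single w c) = scal c * word_der h d w"
  unfolding LD_def by (subst hsum_single) simp_all
lemma LD_add: "LD h d (a + b) = LD h d a + LD h d b"
  unfolding LD_def by (subst hsum_add) (simp_all add: scal_add algebra_simps)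
lemma LD_0: "LD h d 0 = 0" using LD_add[of h d 0 0] by simp
lemma LD_uminus: "LD h d (-a) = - LD h d a"
  using LD_add[of h d a "-a"] by (simp add: LD_0 eq_neg_iff_add_eq_0 add.commute)
lemma LD_diff: "LD h d (a - b) = LD h d a - LD h d b"
  using LD_add[of h d a "-b"] by (simp add: LD_uminus)
lemma LD_scal: "LD h d (scal c * a) = scal c * LD h d a"
proof (induction a rule: falg_induct)
  case (single w c')
  have "scal c * Poly_Mapping.single w c' = Poly_Mapping.single w (c * c')"
    by (simp add: scal_def mult_single plus_list_def)
  then show ?case by (simp add: LD_single scal_mult mult.assoc)
qed (simp_all add: LD_add algebra_simps)

lemma LD_var: "LD h d (var g * a) =
   var g * LD h d a + scal (fst (perm h d g)) * LD h (snd (perm h d g)) a"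
proof (induction a rule: falg_induct)
  case (single w c)
  then show ?case
    by (simp add: LD_single flip: single_Cons)
       (simp add: distrib_left case_prod_unfold scal_left_comm mult.assoc flip: scal_mult,
        simp add: mult.commute flip: mult.assoc scal_mult)
qed (simp_all add: LD_add algebra_simps)

definition LQ :: "'c::field \<Rightarrow> 'c falg \<Rightarrow> 'c falg" where
  "LQ h a = var GX * LD h DX a + var GY * LD h DY a + var GZ * LD h DZ a"

lemma LQ_single: "LQ h (Poly_Mapping.single w c) = scal c * word_Q h w"
  by (simp add: LQ_def word_Q_def LD_single scal_left_comm algebra_simps)

lemma LQ_add: "LQ h (a + b) = LQ h a + LQ h b"
  by (simp add: LQ_def LD_add algebra_simps)
lemma LQ_scal: "LQ h (scal c * a) = scal c * LQ h a"
  by (simp add: LQ_def LD_scal scal_left_comm algebra_simps)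

lemma falg_ring_ring: "ring falg_ring"
  unfolding falg_ring_def
  by (intro ringI abelian_groupI monoidI)
    (auto simp: algebra_simps intro: exI[of _ "- x" for x])

definition isideal :: "'c::field falg set \<Rightarrow> bool" where
  "isideal I \<longleftrightarrow> 0 \<in> I \<and> (\<forall>a\<in>I. \<forall>b\<in>I. a + b \<in> I) \<and> (\<forall>a\<in>I. \<forall>r. r * a \<in> I \<and> a * r \<in> I)"

lemma isideal_uminus: "isideal I \<Longrightarrow> a \<in> I \<Longrightarrow> - a \<in> I"
  unfolding isideal_def by (metis mult_minus1)

lemma isideal_diff: "isideal I \<Longrightarrow> a \<in> I \<Longrightarrow> b \<in> I \<Longrightarrow> a - b \<in> I"
  using isideal_uminus[of I b] unfolding isideal_def by (metis diff_conv_add_uminus)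

lemma ideal_conv: "ideal I falg_ring \<longleftrightarrow> isideal I"
proof
  assume I: "ideal I falg_ring"
  interpret ideal I falg_ring by fact
  show "isideal I" unfolding isideal_def
    using additive_subgroup.a_closed[OF is_additive_subgroup] I_l_closed I_r_closed
    additive_subgroup.zero_closed[OF is_additive_subgroup]
    by (auto simp: falg_ring_def)
next
  assume I: "isideal I"
  interpret ring falg_ring by (rule falg_ring_ring)
  show "ideal I falg_ring"
  proof (rule idealI[OF falg_ring_ring])
    show "subgroup I (add_monoid falg_ring)"
    proof (rule group.subgroupI)
      show "Group.group (add_monoid falg_ring)" by (rule a_group)
      fix a assume a: "a \<in> I"
      have "inv\<^bsub>add_monoid falg_ring\<^esub> a = - a"
        using minus_equality[of "-a" a] by (simp add: falg_ring_def a_inv_def)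
      then show "inv\<^bsub>add_monoid falg_ring\<^esub> a \<in> I" using isideal_uminus[OF I a] by simp
    qed (use I in \<open>auto simp: isideal_def falg_ring_def\<close>)
  qed (use I in \<open>auto simp: isideal_def falg_ring_def\<close>)
qed

lemma isideal_mu: "isideal (mu_ideal h)"
  unfolding ideal_conv[symmetric] mu_ideal_def
  by (rule ring.genideal_ideal[OF falg_ring_ring]) (simp add: falg_ring_def)

lemma relators_mu_ideal: "r \<in> mu_relators h \<Longrightarrow> r \<in> mu_ideal h"
  using ring.genideal_self[OF falg_ring_ring, of "mu_relators h"]
  by (auto simp: mu_ideal_def mu_relators_def falg_ring_def)

lemma mu_ideal_minimal: "isideal J \<Longrightarrow> mu_relators h \<subseteq> J \<Longrightarrow> mu_ideal h \<subseteq> J"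
  unfolding ideal_conv[symmetric] mu_ideal_def mu_relators_def
  by (rule ring.genideal_minimal[OF falg_ring_ring])

inductive_set ispan for S :: "'c::field falg set" where
  zero: "0 \<in> ispan S"
| gen: "r \<in> S \<Longrightarrow> Poly_Mapping.single u f * r * Poly_Mapping.single v 1 \<in> ispan S"
| add: "a \<in> ispan S \<Longrightarrow> b \<in> ispan S \<Longrightarrow> a + b \<in> ispan S"

lemma ispan_ideal: "isideal (ispan (S :: 'c::field falg set))"
proof -
  have 1: "r * a \<in> ispan S" if "a \<in> ispan S" for r a
  proof (induction r rule: falg_induct)
    case (single w c)
    show ?case using that
    proof induction
      case (gen r u f v)
      have "Poly_Mapping.single w c * (Poly_Mapping.single u f * r * Poly_Mapping.single v 1)
        = Poly_Mapping.single (w @ u) (c * f) * r * Poly_Mapping.single v 1"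
        by (simp add: mult_single plus_list_def flip: mult.assoc)
      then show ?case using gen ispan.gen by metis
    qed (auto simp: algebra_simps intro: ispan.intros)
  qed (use that in \<open>auto simp: algebra_simps intro: ispan.intros\<close>)
  have 2: "a * r \<in> ispan S" if "a \<in> ispan S" for r a
  proof (induction r rule: falg_induct)
    case (single w c)
    show ?case using that
    proof induction
      case (gen r u f v)
      have "(Poly_Mapping.single u f * r * Poly_Mapping.single v 1) * Poly_Mapping.single w c
        = Poly_Mapping.single u f * r * (Poly_Mapping.single (v @ w) 1 * scal c)"
        by (simp add: mult_single plus_list_def mult.assoc scal_def)
      also have "\<dots> = scal c * Poly_Mapping.single u f * r * Poly_Mapping.single (v @ w) 1"
        by (metis scal_comm mult.assoc)
      also have "\<dots> = Poly_Mapping.single u (c * f) * r * Poly_Mapping.single (v @ w) 1"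
        by (simp add: mult_single plus_list_def scal_def)
      finally show ?case using gen ispan.gen by metis
    qed (auto simp: algebra_simps intro: ispan.intros)
  qed (use that in \<open>auto simp: algebra_simps intro: ispan.intros\<close>)
  show ?thesis unfolding isideal_def using 1 2 ispan.intros by blast
qed

lemma ispan_self: "r \<in> S \<Longrightarrow> r \<in> ispan S"
  using ispan.gen[of r S "[]" 1 "[]"] by (simp flip: scal_def)

lemma ispan_idealD:
  "0 \<in> ispan S" "a \<in> ispan S \<Longrightarrow> b \<in> ispan S \<Longrightarrow> a + b \<in> ispan S"
  "a \<in> ispan S \<Longrightarrow> b \<in> ispan S \<Longrightarrow> a - b \<in> ispan S"
  "a \<in> ispan S \<Longrightarrow> - a \<in> ispan S"
  "a \<in> ispan S \<Longrightarrow> r * a \<in> ispan S" "a \<in> ispan S \<Longrightarrow> a * r \<in> ispan S"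
  using ispan_ideal[of S] isideal_diff[of "ispan S"] isideal_uminus[of "ispan S"]
  by (auto simp: isideal_def)

abbreviation "G h \<equiv> ispan (u2_relators h)"

lemma LD_rel:
  fixes h :: "'c::field_char_0"
  assumes "r \<in> u2_relators h"
  shows "LD h d (r * a) = r * LD h d a"
proof -
  define s where "s = scal (h/2)"
  have h: "scal h = s + s" by (simp add: s_def flip: scal_add)
  have s: "scal (h/2) = s" "scal (-h/2) = -s" "scal (-(h/2)) = -s" by (simp_all add: s_def flip: scal_uminus)
  have c: "var g * s = s * var g" "var g * (s * x) = s * (var g * x)" for g x
    by (simp_all add: s_def scal_comm_var scal_left_comm)
  have L: "LD h d (s * x) = s * LD h d x" for d x by (simp add: s_def LD_scal)
  note R = h s c L LD_diff LD_add LD_var distrib_left distrib_right left_diff_distrib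
    right_diff_distrib mult.assoc
  from assms show ?thesis unfolding u2_relators_def
    by (cases d) (auto simp: R)
qed

lemma LD_G:
  fixes h :: "'c::field_char_0"
  shows "a \<in> G h \<Longrightarrow> LD h d a \<in> G h"
proof (induction arbitrary: d rule: ispan.induct)
  case (gen r u f v)
  have "LD h d (Poly_Mapping.single u f * r * x) \<in> G h" for x d
  proof (induction u arbitrary: d)
    case Nil
    show ?case using gen by (simp add: single_Nil mult.assoc LD_scal LD_rel ispan_idealD ispan_self)
  next
    case (Cons g u)
    then show ?case by (simp add: single_Cons mult.assoc LD_var ispan_idealD)
  qed
  then show ?case .
qed (simp_all add: LD_0 LD_add ispan_idealD)

lemma LQ_G:
  fixes h :: "'c::field_char_0"
  shows "a \<in> G h \<Longrightarrow> LQ h a \<in> G h"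
  by (simp add: LQ_def LD_G ispan_idealD)

lemma Cas_var:
  fixes h :: "'c::field"
  shows "var g * Cas - Cas * var g \<in> G h"
proof -
  let ?x = "var GX :: 'c::field falg" and ?y = "var GY :: 'c falg" and ?z = "var GZ :: 'c falg"
    and ?t = "var GT :: 'c falg"
  let ?h = "scal h :: 'c falg"
  have r: "?x * ?y - ?y * ?x - ?h * ?z \<in> G h" (is "?r1 \<in> _")
    "?y * ?z - ?z * ?y - ?h * ?x \<in> G h" (is "?r2 \<in> _")
    "?z * ?x - ?x * ?z - ?h * ?y \<in> G h" (is "?r3 \<in> _")
    by (auto intro!: ispan_self simp: u2_relators_def)
  have t: "?t * ?x - ?x * ?t \<in> G h" (is "?t1 \<in> _")
    "?t * ?y - ?y * ?t \<in> G h" (is "?t2 \<in> _")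
    "?t * ?z - ?z * ?t \<in> G h" (is "?t3 \<in> _")
    by (auto intro!: ispan_self simp: u2_relators_def)
  note D = Cas_def power2_eq_square distrib_left distrib_right left_diff_distrib
    right_diff_distrib mult.assoc scal_comm_var scal_left_comm
  show ?thesis
  proof (cases g)
    case GX
    have "?x * Cas - Cas * ?x = ?r1 * ?y + ?y * ?r1 - (?r3 * ?z + ?z * ?r3)"
      by (simp add: D)
    then show ?thesis using r GX by (simp add: ispan_idealD)
  next
    case GY
    have "?y * Cas - Cas * ?y = ?r2 * ?z + ?z * ?r2 - (?r1 * ?x + ?x * ?r1)"
      by (simp add: D)
    then show ?thesis using r GY by (simp add: ispan_idealD)
  next
    case GZ
    have "?z * Cas - Cas * ?z = ?r3 * ?x + ?x * ?r3 - (?r2 * ?y + ?y * ?r2)"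
      by (simp add: D)
    then show ?thesis using r GZ by (simp add: ispan_idealD)
  next
    case GT
    have "?t * Cas - Cas * ?t = ?t1 * ?x + ?x * ?t1 + (?t2 * ?y + ?y * ?t2) + (?t3 * ?z + ?z * ?t3)"
      by (simp add: D)
    then show ?thesis using t GT by (simp add: ispan_idealD)
  qed
qed

lemma Cas_word: "Poly_Mapping.single u 1 * Cas - Cas * Poly_Mapping.single u 1 \<in> G h"
proof (induction u)
  case Nil
  then show ?case by (simp add: single_Nil ispan_idealD)
next
  case (Cons g u)
  have "Poly_Mapping.single (g # u) 1 * Cas - Cas * Poly_Mapping.single (g # u) 1
    = var g * (Poly_Mapping.single u 1 * Cas - Cas * Poly_Mapping.single u 1)
      + (var g * Cas - Cas * var g) * Poly_Mapping.single u (1::'a)"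
    by (simp add: single_Cons algebra_simps)
  then show ?case using Cons Cas_var[of g h] by (simp add: ispan_idealD)
qed

text \<open>
  \<open>LD_Cas\<close> and \<open>LQ_Cas\<close> are the rows of the identity \<open>(DT, Q) Cas = Phi (DT, Q)\<close>; the second one
  holds modulo the relations only.
\<close>

lemma LD_Cas:
  fixes h :: "'c::field_char_0"
  shows "LD h DT (Cas * a) = (Cas - scal (3/4 * h^2)) * LD h DT a - scal h * LQ h a"
proof -
  define s where "s = scal (h/2)"
  have h: "scal h = s + s" by (simp add: s_def flip: scal_add)
  have h2: "scal (3 * h^2 / 4) = s * s + s * s + s * s"
    by (simp add: s_def power2_eq_square flip: scal_add scal_mult)
  have s: "scal (h/2) = s" "scal (-h/2) = -s" "scal (-(h/2)) = -s" by (simp_all add: s_def flip: scal_uminus)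
  have c: "var g * s = s * var g" "var g * (s * x) = s * (var g * x)" for g x
    by (simp_all add: s_def scal_comm_var scal_left_comm)
  have L: "LD h d (s * x) = s * LD h d x" for d x by (simp add: s_def LD_scal)
  show ?thesis unfolding Cas_def power2_eq_square[of "var _"]
    by (simp add: h h2 s c L LD_diff LD_add LD_var LQ_def distrib_left distrib_right left_diff_distrib
    right_diff_distrib mult.assoc)
qed

lemma LQ_Cas:
  fixes h :: "'c::field_char_0"
  shows "LQ h (Cas * a) - (scal h * Cas * LD h DT a + (Cas + scal (h^2/4)) * LQ h a) \<in> G h"
proof -
  define s where "s = scal (h/2)"
  have h: "scal h = s + s" by (simp add: s_def flip: scal_add)
  have h2: "scal (h^2/4) = s * s"
    by (simp add: s_def power2_eq_square flip: scal_add scal_mult)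
  have s: "scal (h/2) = s" "scal (-h/2) = -s" "scal (-(h/2)) = -s" by (simp_all add: s_def flip: scal_uminus)
  have c: "var g * s = s * var g" "var g * (s * x) = s * (var g * x)" for g x
    by (simp_all add: s_def scal_comm_var scal_left_comm)
  have L: "LD h d (s * x) = s * LD h d x" for d x by (simp add: s_def LD_scal)
  let ?x = "var GX :: 'c falg" and ?y = "var GY :: 'c falg" and ?z = "var GZ :: 'c falg"
  let ?X = "LD h DX a" and ?Y = "LD h DY a" and ?Z = "LD h DZ a"
  let ?h = "scal h :: 'c falg"
  have r: "?x * ?y - ?y * ?x - ?h * ?z \<in> G h" (is "?r1 \<in> _")
    "?y * ?z - ?z * ?y - ?h * ?x \<in> G h" (is "?r2 \<in> _")
    "?z * ?x - ?x * ?z - ?h * ?y \<in> G h" (is "?r3 \<in> _")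
    by (auto intro!: ispan_self simp: u2_relators_def)
  have "LQ h (Cas * a) - (scal h * Cas * LD h DT a + (Cas + scal (h^2/4)) * LQ h a)
    = (?x * Cas - Cas * ?x) * ?X + (?y * Cas - Cas * ?y) * ?Y + (?z * Cas - Cas * ?z) * ?Z
     + scal h * (?r1 * ?Z + ?r2 * ?X + ?r3 * ?Y)"
    unfolding Cas_def power2_eq_square[of "var _"]
    by (simp add: h h2 s c L LD_diff LD_add LD_var LQ_def distrib_left distrib_right left_diff_distrib
    right_diff_distrib mult.assoc)
  also have "\<dots> \<in> G h" using r Cas_var[of _ h] by (simp add: ispan_idealD)
  finally show ?thesis .
qed


instance fract :: ("{idom,ring_char_0}") field_char_0
proof
  show "inj (of_nat :: nat \<Rightarrow> 'a fract)"
    by (rule injI) (simp add: of_nat_fract eq_fract)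
qed

lemma cnst_ring: "cnst (a + c) = cnst a + cnst c" "cnst (a * c) = cnst a * cnst c"
  "cnst (a - c) = cnst a - cnst c" "cnst (- a) = - cnst a" "cnst 1 = 1" "cnst 0 = 0"
  by (simp_all add: cnst_def One_fract_def Zero_fract_def mult.commute flip: one_pCons)

lemma cnst_numeral: "cnst (of_nat n) = of_nat n"
  by (induction n) (simp_all add: cnst_ring)

lemma cnst_num [simp]: "cnst (numeral n) = numeral n"
  using cnst_numeral[of "numeral n"] by simp

lemma cnst_eq_0 [simp]: "cnst c = 0 \<longleftrightarrow> c = 0"
  by (simp add: cnst_def Zero_fract_def eq_fract)

lemma cnst_inverse: "cnst (inverse c) = inverse (cnst c)"
proof (cases "c = 0")
  case False
  then have "cnst c * cnst (inverse c) = 1" by (simp flip: cnst_ring)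
  then show ?thesis by (metis inverse_unique)
qed (simp add: cnst_ring)

lemma cnst_divide: "cnst (a / c) = cnst a / cnst c"
  by (simp add: divide_inverse cnst_ring cnst_inverse)

lemma mu_neq_cnst: "mu + cnst c \<noteq> 0" "mu - cnst c \<noteq> 0" "mu \<noteq> 0"
  by (simp_all add: mu_def cnst_def Zero_fract_def eq_fract)

lemma subst_add: "subst_mu c (f + g) = subst_mu c f + subst_mu c g"
  by (induction f; induction g)
    (simp add: subst_mu_Fract pcompose_eq_0_iff pcompose_add pcompose_mult)

lemma subst_mult: "subst_mu c (f * g) = subst_mu c f * subst_mu c g"
  by (induction f; induction g)
    (simp add: subst_mu_Fract pcompose_eq_0_iff pcompose_add pcompose_mult)

lemma subst_cnst [simp]: "subst_mu c (cnst a) = cnst a"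
  by (simp add: cnst_def subst_mu_Fract pcompose_1)
lemma subst_mu [simp]: "subst_mu c mu = mu + cnst c"
  by (simp add: mu_def cnst_def subst_mu_Fract pcompose_pCons pcompose_1)
lemma subst_0 [simp]: "subst_mu c 0 = 0" using subst_cnst[of c 0] by (simp add: cnst_ring)
lemma subst_1 [simp]: "subst_mu c 1 = 1" using subst_cnst[of c 1] by (simp add: cnst_ring)
lemma subst_inverse: "subst_mu c (inverse f) = inverse (subst_mu c f)"
proof (cases "f = 0")
  case False
  then have "subst_mu c f * subst_mu c (inverse f) = 1" by (simp flip: subst_mult)
  then show ?thesis by (metis inverse_unique)
qed simp
lemma subst_power: "subst_mu c (f ^ n) = subst_mu c f ^ n"
  by (induction n) (simp_all add: subst_mult)
lemma subst_powi: "subst_mu c (f powi n) = subst_mu c f powi n"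
  by (simp add: power_int_def subst_power subst_inverse)

lemma moved_nth: "moved h f $ i $ j = scal (subst_mu (-h) f) * P1 h $ i $ j + scal (subst_mu h f) * P2 h $ i $ j"
  by (simp add: moved_def)

lemma moved_add: "moved h (f + g) = moved h f + moved h g"
  by (simp add: vec_eq_iff moved_nth subst_add scal_add algebra_simps)
lemma moved_0: "moved h 0 = 0"
  by (simp add: vec_eq_iff moved_nth)
lemma moved_cnst: "(moved h (f * cnst c) *v x) $ i = scal (cnst c) * (moved h f *v x) $ i"
proof -
  have "scal (subst_mu d f * cnst c) * y = scal (cnst c) * (scal (subst_mu d f) * y)" for d y
    by (simp add: mult.commute flip: scal_mult mult.assoc)
  then show ?thesis
    by (simp add: matrix_vector_mult_def moved_nth subst_mult sum_distrib_left distrib_left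
      distrib_right mult.assoc)
qed

lemma DT_Q_hsum: "DT_Q h = hsum (\<lambda>f w. moved h f *v vector [word_der (cnst h) DT w, word_Q (cnst h) w])"
  by (rule ext) (simp add: DT_Q_def hsum_def)

lemma DT_Q_single: "DT_Q h (Poly_Mapping.single w f) =
  moved h f *v vector [word_der (cnst h) DT w, word_Q (cnst h) w]"
  unfolding DT_Q_hsum by (subst hsum_single) (simp_all add: moved_0)

lemma DT_Q_add: "DT_Q h (a + b) = DT_Q h a + DT_Q h b"
  unfolding DT_Q_hsum
  by (rule hsum_add) (simp_all add: moved_0 moved_add matrix_vector_mult_add_rdistrib)

text \<open>
  \<open>CC\<close> is the complex span of the words, i.e. the elements not involving \<open>\<mu>\<close>.  On products of a
  function of \<open>\<mu>\<close> with such an element \<open>DT_Q\<close> is given by \<open>DT_Q_scal\<close>.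
\<close>

inductive_set CC :: "ratfun falg set" where
  single: "Poly_Mapping.single w (cnst c) \<in> CC"
| add: "a \<in> CC \<Longrightarrow> b \<in> CC \<Longrightarrow> a + b \<in> CC"

lemma CC_mult: "a \<in> CC \<Longrightarrow> b \<in> CC \<Longrightarrow> a * b \<in> CC"
proof (induction a rule: CC.induct)
  case (single w c)
  from \<open>b \<in> CC\<close> show ?case
    by induction (auto simp: mult_single distrib_left CC.intros simp flip: cnst_ring)
qed (simp add: distrib_right CC.add)

lemma CC_scal: "scal (cnst c) \<in> CC" by (simp add: scal_def CC.single)
lemma CC_word: "Poly_Mapping.single w 1 \<in> CC" using CC.single[of w 1] by (simp add: cnst_ring)
lemma CC_var: "var g \<in> CC" by (simp add: var_def CC_word)
lemma CC_uminus: "a \<in> CC \<Longrightarrow> - a \<in> CC"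
  using CC_mult[OF CC_scal[of "-1"], of a] by (simp add: cnst_ring scal_uminus)
lemma CC_diff: "a \<in> CC \<Longrightarrow> b \<in> CC \<Longrightarrow> a - b \<in> CC"
  using CC.add[of a "- b"] CC_uminus by simp
lemma CC_power: "a \<in> CC \<Longrightarrow> a ^ n \<in> CC"
  using CC_scal[of 1] by (induction n) (simp_all add: CC_mult cnst_ring)
lemma CC_Cas: "Cas \<in> CC" by (simp add: Cas_def CC.add CC_var CC_power)
lemma CC_rel: "r \<in> u2_relators (cnst h) \<Longrightarrow> r \<in> CC"
  by (auto simp: u2_relators_def intro!: CC_diff CC_mult CC_var CC_scal)

lemma DT_Q_scal:
  assumes "a \<in> CC"
  shows "DT_Q h (scal f * a) = moved h f *v vector [LD (cnst h) DT a, LQ (cnst h) a]"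
  using assms
proof induction
  case (single w c)
  have "scal f * Poly_Mapping.single w (cnst c) = Poly_Mapping.single w (f * cnst c)"
    by (simp add: scal_def mult_single plus_list_def)
  moreover have "(moved h (f * cnst c) *v vector [x, y]) = moved h f *v vector [scal (cnst c) * x, scal (cnst c) * y]" for x y
  proof -
    have "m * (scal (cnst c) * y) = scal (cnst c) * (m * y)" for m y :: "ratfun falg"
      by (simp add: scal_comm[of m] flip: mult.assoc)
    then show ?thesis
      by (simp add: vec_eq_iff moved_cnst) (simp add: matrix_vector_mult_def sum_2 forall_2 distrib_left)
  qed
  ultimately show ?case
    by (simp add: DT_Q_single LD_single LQ_single)
next
  case (add a b)
  have "vector [x + x', y + y'] = (vector [x, y] + vector [x', y'] :: ratfun falg^2)" for x y x' y'
    by (simp add: vec_eq_iff forall_2)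
  then show ?case using add by (simp add: distrib_left DT_Q_add LD_add LQ_add matrix_vector_right_distrib)
qed

lemma G_mu_ideal: "a \<in> G (cnst h) \<Longrightarrow> a \<in> mu_ideal h"
proof (induction rule: ispan.induct)
  case (gen r u f v)
  then show ?case using isideal_mu[of h] relators_mu_ideal[of r h] by (auto simp: isideal_def mu_relators_def)
qed (use isideal_mu[of h] in \<open>auto simp: isideal_def\<close>)

definition eqv :: "complex \<Rightarrow> ratfun falg \<Rightarrow> ratfun falg \<Rightarrow> bool" where
  "eqv h a c \<longleftrightarrow> a - c \<in> mu_ideal h"

lemma mu_idealD: "0 \<in> mu_ideal h" "a \<in> mu_ideal h \<Longrightarrow> c \<in> mu_ideal h \<Longrightarrow> a + c \<in> mu_ideal h"
  "a \<in> mu_ideal h \<Longrightarrow> c \<in> mu_ideal h \<Longrightarrow> a - c \<in> mu_ideal h"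
  "a \<in> mu_ideal h \<Longrightarrow> r * a \<in> mu_ideal h" "a \<in> mu_ideal h \<Longrightarrow> a * r \<in> mu_ideal h"
  "a \<in> mu_ideal h \<Longrightarrow> - a \<in> mu_ideal h"
  using isideal_mu[of h] isideal_diff[OF isideal_mu] isideal_uminus[OF isideal_mu] by (auto simp: isideal_def)

lemma eqv_refl: "eqv h a a" by (simp add: eqv_def mu_idealD)
lemma eqv_sym: "eqv h a c \<Longrightarrow> eqv h c a" using mu_idealD(6)[of "a - c" h] by (simp add: eqv_def)
lemma eqv_trans [trans]: "eqv h a c \<Longrightarrow> eqv h c d \<Longrightarrow> eqv h a d"
  using mu_idealD(2)[of "a - c" h "c - d"] by (simp add: eqv_def)
lemma eqv_add: "eqv h a c \<Longrightarrow> eqv h a' c' \<Longrightarrow> eqv h (a + a') (c + c')"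
  using mu_idealD(2)[of "a - c" h "a' - c'"] by (simp add: eqv_def algebra_simps)
lemma eqv_diff: "eqv h a c \<Longrightarrow> eqv h a' c' \<Longrightarrow> eqv h (a - a') (c - c')"
  using mu_idealD(3)[of "a - c" h "a' - c'"] by (simp add: eqv_def algebra_simps)
lemma eqv_mult: "eqv h a c \<Longrightarrow> eqv h a' c' \<Longrightarrow> eqv h (a * a') (c * c')"
proof -
  assume "eqv h a c" "eqv h a' c'"
  then have "(a - c) * a' + c * (a' - c') \<in> mu_ideal h"
    by (simp add: eqv_def mu_idealD)
  then show ?thesis by (simp add: eqv_def algebra_simps)
qed

definition gam :: "complex \<Rightarrow> ratfun" where "gam h = (cnst h ^ 2 - mu ^ 2) / 4"

lemma eqv_Cas: "eqv h Cas (scal (gam h))"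
proof -
  have "scal (mu^2) - (scal (cnst h ^ 2) - scal 4 * Cas) \<in> mu_ideal h"
    by (rule relators_mu_ideal) (simp add: mu_relators_def)
  then have "scal (1/4) * (scal (mu^2) - (scal (cnst h ^ 2) - scal 4 * Cas)) \<in> mu_ideal h"
    by (rule mu_idealD)
  also have "scal (1/4) * (scal (mu^2) - (scal (cnst h ^ 2) - scal 4 * Cas)) = Cas - scal (gam h)"
    by (simp add: gam_def right_diff_distrib scal_diff diff_divide_distrib flip: scal_mult mult.assoc)
  finally show ?thesis by (simp add: eqv_def)
qed

lemma Phi_nth: "Phi h $ 1 $ 1 = Cas - scal (3/4 * cnst h ^ 2)" "Phi h $ 1 $ 2 = - scal (cnst h)"
  "Phi h $ 2 $ 1 = scal (cnst h) * Cas" "Phi h $ 2 $ 2 = Cas + scal (cnst h ^ 2 / 4)"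
  by (simp_all add: Phi_def)

lemmas eqvI = eqv_add eqv_diff eqv_mult eqv_Cas eqv_refl

lemma eqv_P1:
  assumes "h \<noteq> 0"
  shows "eqv h (P1 h $ 1 $ 1) (scal ((mu - cnst h) / (2 * mu)))"
    "eqv h (P1 h $ 1 $ 2) (scal (-1 / mu))"
    "eqv h (P1 h $ 2 $ 1) (scal (gam h / mu))"
    "eqv h (P1 h $ 2 $ 2) (scal ((mu + cnst h) / (2 * mu)))"
proof -
  have l: "lam1 h - lam2 h = mu * cnst h" by (simp add: lam1_def lam2_def field_simps)
  have c: "cnst h \<noteq> 0" using assms by simp
  let ?s = "scal (1 / (mu * cnst h))"
  have "eqv h (P1 h $ 1 $ 1) (?s * (scal (gam h) - scal (3/4 * cnst h ^ 2) - scal (lam2 h)))"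
    by (simp add: P1_def l Phi_nth mat_def) (intro eqvI)
  also have "?s * (scal (gam h) - scal (3/4 * cnst h ^ 2) - scal (lam2 h)) = scal ((mu - cnst h) / (2 * mu))"
    unfolding scal_diff[symmetric] scal_mult[symmetric]
    using c mu_neq_cnst(3) by (intro arg_cong[of _ _ scal]) (simp add: gam_def lam2_def field_simps power2_eq_square)
  finally show "eqv h (P1 h $ 1 $ 1) (scal ((mu - cnst h) / (2 * mu)))" .
  have "P1 h $ 1 $ 2 = ?s * scal (- cnst h)" by (simp add: P1_def l Phi_nth mat_def scal_uminus)
  also have "\<dots> = scal (-1/mu)"
    unfolding scal_mult[symmetric] using c by simp
  finally show "eqv h (P1 h $ 1 $ 2) (scal (-1/mu))" by (simp add: eqv_refl)
  have "eqv h (P1 h $ 2 $ 1) (?s * (scal (cnst h) * scal (gam h)))"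
    by (simp add: P1_def l Phi_nth mat_def) (intro eqvI)
  also have "?s * (scal (cnst h) * scal (gam h)) = scal (gam h / mu)"
    unfolding scal_mult[symmetric] using c by simp
  finally show "eqv h (P1 h $ 2 $ 1) (scal (gam h / mu))" .
  have "eqv h (P1 h $ 2 $ 2) (?s * (scal (gam h) + scal (cnst h ^ 2 / 4) - scal (lam2 h)))"
    by (simp add: P1_def l Phi_nth mat_def) (intro eqvI)
  also have "?s * (scal (gam h) + scal (cnst h ^ 2 / 4) - scal (lam2 h)) = scal ((mu + cnst h) / (2 * mu))"
    unfolding scal_diff[symmetric] scal_add[symmetric] scal_mult[symmetric]
    using c mu_neq_cnst(3) by (intro arg_cong[of _ _ scal]) (simp add: gam_def lam2_def field_simps power2_eq_square)
  finally show "eqv h (P1 h $ 2 $ 2) (scal ((mu + cnst h) / (2 * mu)))" .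
qed

lemma eqv_P2:
  assumes "h \<noteq> 0"
  shows "eqv h (P2 h $ 1 $ 1) (scal ((mu + cnst h) / (2 * mu)))"
    "eqv h (P2 h $ 1 $ 2) (scal (1 / mu))"
    "eqv h (P2 h $ 2 $ 1) (scal (- gam h / mu))"
    "eqv h (P2 h $ 2 $ 2) (scal ((mu - cnst h) / (2 * mu)))"
proof -
  have l: "lam2 h - lam1 h = - mu * cnst h" by (simp add: lam1_def lam2_def field_simps)
  have c: "cnst h \<noteq> 0" using assms by simp
  let ?s = "scal (1 / (- mu * cnst h))"
  have "eqv h (P2 h $ 1 $ 1) (?s * (scal (gam h) - scal (3/4 * cnst h ^ 2) - scal (lam1 h)))"
    by (simp only: P2_def l nth_map_matrix) (simp add: Phi_nth mat_def, intro eqvI)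
  also have "?s * (scal (gam h) - scal (3/4 * cnst h ^ 2) - scal (lam1 h)) = scal ((mu + cnst h) / (2 * mu))"
    unfolding scal_diff[symmetric] scal_mult[symmetric]
    using c mu_neq_cnst(3) by (intro arg_cong[of _ _ scal]) (simp add: gam_def lam1_def field_simps power2_eq_square)
  finally show "eqv h (P2 h $ 1 $ 1) (scal ((mu + cnst h) / (2 * mu)))" .
  have "P2 h $ 1 $ 2 = ?s * scal (- cnst h)" by (simp add: P2_def l Phi_nth mat_def scal_uminus)
  also have "\<dots> = scal (1/mu)"
    unfolding scal_mult[symmetric] using c by simp
  finally show "eqv h (P2 h $ 1 $ 2) (scal (1/mu))" by (simp add: eqv_refl)
  have "eqv h (P2 h $ 2 $ 1) (?s * (scal (cnst h) * scal (gam h)))"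
    by (simp only: P2_def l nth_map_matrix) (simp add: Phi_nth mat_def, intro eqvI)
  also have "?s * (scal (cnst h) * scal (gam h)) = scal (- gam h / mu)"
    unfolding scal_mult[symmetric] using c by simp
  finally show "eqv h (P2 h $ 2 $ 1) (scal (- gam h / mu))" .
  have "eqv h (P2 h $ 2 $ 2) (?s * (scal (gam h) + scal (cnst h ^ 2 / 4) - scal (lam1 h)))"
    by (simp only: P2_def l nth_map_matrix) (simp add: Phi_nth mat_def, intro eqvI)
  also have "?s * (scal (gam h) + scal (cnst h ^ 2 / 4) - scal (lam1 h)) = scal ((mu - cnst h) / (2 * mu))"
    unfolding scal_diff[symmetric] scal_add[symmetric] scal_mult[symmetric]
    using c mu_neq_cnst(3) by (intro arg_cong[of _ _ scal]) (simp add: gam_def lam1_def field_simps power2_eq_square)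
  finally show "eqv h (P2 h $ 2 $ 2) (scal ((mu - cnst h) / (2 * mu)))" .
qed


definition mv :: "complex \<Rightarrow> ratfun \<Rightarrow> 2 \<Rightarrow> 2 \<Rightarrow> ratfun" where
  "mv h f i j = (let u = subst_mu (-h) f; v = subst_mu h f in
     if i = 1 then (if j = 1 then u * ((mu - cnst h) / (2*mu)) + v * ((mu + cnst h) / (2*mu)) else (v - u) / mu)
     else (if j = 1 then (u - v) * gam h / mu else u * ((mu + cnst h) / (2*mu)) + v * ((mu - cnst h) / (2*mu))))"

lemma eqv_moved:
  assumes "h \<noteq> 0"
  shows "eqv h (moved h f $ i $ j) (scal (mv h f i j))"
proof -
  let ?u = "subst_mu (-h) f" and ?v = "subst_mu h f"
  note e = eqv_P1[OF assms] eqv_P2[OF assms]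
  have *: "eqv h (moved h f $ i $ j) (scal (?u * p + ?v * q))"
    if "eqv h (P1 h $ i $ j) (scal p)" "eqv h (P2 h $ i $ j) (scal q)" for p q
    unfolding moved_nth scal_add scal_mult by (intro eqv_add eqv_mult eqv_refl that)
  consider "i = 1 \<and> j = 1" | "i = 1 \<and> j = 2" | "i = 2 \<and> j = 1" | "i = 2 \<and> j = 2"
    using exhaust_2 by blast
  then show ?thesis
  proof cases
    case 1
    have "mv h f 1 1 = ?u * ((mu - cnst h) / (2*mu)) + ?v * ((mu + cnst h) / (2*mu))"
      by (simp add: mv_def Let_def)
    then show ?thesis using * e(1,5) 1 by metis
  next
    case 2
    have "mv h f 1 2 = ?u * (-1/mu) + ?v * (1/mu)"
      using mu_neq_cnst(3) by (simp add: mv_def Let_def field_simps)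
    then show ?thesis using * e(2,6) 2 by metis
  next
    case 3
    have "mv h f 2 1 = ?u * (gam h/mu) + ?v * (- gam h/mu)"
      using mu_neq_cnst(3) by (simp add: mv_def Let_def field_simps)
    then show ?thesis using * e(3,7) 3 by metis
  next
    case 4
    have "mv h f 2 2 = ?u * ((mu + cnst h) / (2*mu)) + ?v * ((mu - cnst h) / (2*mu))"
      by (simp add: mv_def Let_def)
    then show ?thesis using * e(4,8) 4 by metis
  qed
qed

lemma mat_vec_2: "((A :: ratfun falg^2^2) *v vector [x, y]) $ i = A $ i $ 1 * x + A $ i $ 2 * y"
  by (simp add: matrix_vector_mult_def sum_2)

lemma eqv_DT_Q:
  assumes "h \<noteq> 0" "a \<in> CC" "eqv h (LD (cnst h) DT a) x" "eqv h (LQ (cnst h) a) y"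
  shows "eqv h (DT_Q h (scal f * a) $ i) (scal (mv h f i 1) * x + scal (mv h f i 2) * y)"
  unfolding DT_Q_scal[OF assms(2)] mat_vec_2
  by (intro eqv_add eqv_mult eqv_moved assms)

lemma eqvG: "a - c \<in> G (cnst h) \<Longrightarrow> eqv h a c"
  by (simp add: eqv_def G_mu_ideal)

lemma DT_Q_mu_ideal:
  assumes h: "h \<noteq> 0" and a: "a \<in> mu_ideal h"
  shows "DT_Q h a $ i \<in> mu_ideal h"
proof -
  have "a \<in> ispan (mu_relators h)"
    using mu_ideal_minimal[OF ispan_ideal, of h "mu_relators h"] ispan_self a by blast
  then show ?thesis
  proof induction
    case zero
    then show ?case using DT_Q_single[of h "[]" 0] by (simp add: moved_0 mu_idealD)
  next
    case (add a b)
    then show ?case by (simp add: DT_Q_add mu_idealD)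
  next
    case (gen r u f v)
    let ?u = "Poly_Mapping.single u 1 :: ratfun falg" and ?v = "Poly_Mapping.single v 1 :: ratfun falg"
    have uf: "Poly_Mapping.single u f = scal f * ?u" by (rule single_conv)
    show ?case
    proof (cases "r \<in> u2_relators (cnst h)")
      case True
      let ?a = "?u * r * ?v"
      have C: "?a \<in> CC" by (intro CC_mult CC_word CC_rel[OF True])
      have "?a \<in> G (cnst h)" using True by (intro ispan_idealD ispan_self)
      then have "LD (cnst h) DT ?a \<in> mu_ideal h" "LQ (cnst h) ?a \<in> mu_ideal h"
        by (auto intro!: G_mu_ideal LD_G LQ_G)
      then have "eqv h (DT_Q h (scal f * ?a) $ i) (scal (mv h f i 1) * 0 + scal (mv h f i 2) * 0)"
        by (intro eqv_DT_Q h C) (simp_all add: eqv_def)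
      then show ?thesis by (simp add: eqv_def uf mult.assoc)
    next
      case False
      then have r: "r = scal (mu^2) - (scal (cnst h ^ 2) - scal 4 * Cas)"
        using gen by (simp add: mu_relators_def)
      let ?w = "?u * ?v" and ?c = "?u * Cas * ?v"
      define g where "g = mu^2 - cnst h ^ 2"
      have "scal f * ?u * r * ?v = scal f * (?u * ((scal g + scal 4 * Cas) * ?v))"
      proof -
        have "r = scal g + scal 4 * Cas" by (simp add: r g_def scal_diff)
        then show ?thesis by (simp only: mult.assoc)
      qed
      also have "\<dots> = scal f * (?u * scal g) * ?v + scal f * (?u * scal 4) * Cas * ?v"
        by (simp add: distrib_left distrib_right mult.assoc)
      also have "\<dots> = scal (f * g) * ?w + scal (f * 4) * ?c"
        by (simp add: scal_comm[of ?u] scal_mult mult.assoc)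
      finally have 1: "Poly_Mapping.single u f * r * ?v = scal (f * g) * ?w + scal (f * 4) * ?c"
        by (simp add: uf)
      have s4: "subst_mu c 4 = 4" for c using subst_cnst[of c 4] by simp
      have "subst_mu c (g + cnst h ^ 2) = (mu + cnst c)^2" for c
        by (simp add: g_def subst_power)
      then have sg': "subst_mu c g = (mu + cnst c)^2 - cnst h ^ 2" for c
        by (simp add: subst_add subst_power eq_diff_eq)
      have sg: "subst_mu (-h) (f * g) = subst_mu (-h) f * (mu^2 - 2 * mu * cnst h)"
        "subst_mu h (f * g) = subst_mu h f * (mu^2 + 2 * mu * cnst h)"
        "subst_mu c (f * 4) = subst_mu c f * 4" for c
        by (simp_all add: subst_mult sg' s4 cnst_ring power2_eq_square algebra_simps)
      have C: "?w \<in> CC" "?c \<in> CC" by (intro CC_mult CC_word CC_Cas)+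
      let ?D = "LD (cnst h) DT ?w" and ?Q = "LQ (cnst h) ?w"
      have cG: "?c - Cas * ?w \<in> G (cnst h)"
        using ispan_idealD(6)[OF Cas_word[of u "cnst h"], of ?v]
        by (simp add: left_diff_distrib mult.assoc)
      have "eqv h (LD (cnst h) DT ?c) (LD (cnst h) DT (Cas * ?w))"
        by (rule eqvG) (use LD_G[OF cG, of DT] in \<open>simp add: LD_diff\<close>)
      also have "eqv h (LD (cnst h) DT (Cas * ?w)) ((scal (gam h) - scal (3/4 * cnst h^2)) * ?D - scal (cnst h) * ?Q)"
        unfolding LD_Cas by (intro eqvI)
      finally have D: "eqv h (LD (cnst h) DT ?c) ((scal (gam h) - scal (3/4 * cnst h^2)) * ?D - scal (cnst h) * ?Q)" .
      have "LQ (cnst h) ?c - LQ (cnst h) (Cas * ?w) \<in> G (cnst h)"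
        using LQ_G[OF cG] LQ_add[of "cnst h" "?c - Cas * ?w" "Cas * ?w"] by simp
      then have "eqv h (LQ (cnst h) ?c) (LQ (cnst h) (Cas * ?w))"
        by (rule eqvG)
      also have "eqv h (LQ (cnst h) (Cas * ?w)) (scal (cnst h) * Cas * ?D + (Cas + scal (cnst h^2/4)) * ?Q)"
        by (rule eqvG[OF LQ_Cas])
      also have "eqv h (scal (cnst h) * Cas * ?D + (Cas + scal (cnst h^2/4)) * ?Q)
          (scal (cnst h) * scal (gam h) * ?D + (scal (gam h) + scal (cnst h^2/4)) * ?Q)"
        by (intro eqvI)
      finally have Q: "eqv h (LQ (cnst h) ?c) (scal (cnst h) * scal (gam h) * ?D + (scal (gam h) + scal (cnst h^2/4)) * ?Q)" .
      have "eqv h (DT_Q h (scal (f * g) * ?w + scal (f * 4) * ?c) $ i)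
        ((scal (mv h (f * g) i 1) * ?D + scal (mv h (f * g) i 2) * ?Q)
        + (scal (mv h (f * 4) i 1) * ((scal (gam h) - scal (3/4 * cnst h^2)) * ?D - scal (cnst h) * ?Q)
         + scal (mv h (f * 4) i 2) * (scal (cnst h) * scal (gam h) * ?D + (scal (gam h) + scal (cnst h^2/4)) * ?Q)))"
        (is "eqv h _ ?R")
        unfolding DT_Q_add vector_add_component
        by (intro eqv_add eqv_DT_Q h C eqv_refl D Q)
      also have "?R = scal (mv h (f * g) i 1 + mv h (f * 4) i 1 * (gam h - 3/4 * cnst h^2) + mv h (f * 4) i 2 * (cnst h * gam h)) * ?D
         + scal (mv h (f * g) i 2 - mv h (f * 4) i 1 * cnst h + mv h (f * 4) i 2 * (gam h + cnst h^2/4)) * ?Q"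
        (is "_ = scal ?p * _ + scal ?q * _")
        by (simp only: scal_add scal_diff scal_mult distrib_left distrib_right
            left_diff_distrib right_diff_distrib mult.assoc) (simp add: add_ac)
      also have "?p = 0"
        using mu_neq_cnst(3) h 
        by (cases "i = 1") (simp_all add: mv_def Let_def sg gam_def field_simps power2_eq_square)
      also have "?q = 0"
        using mu_neq_cnst(3) h 
        by (cases "i = 1") (simp_all add: mv_def Let_def sg gam_def field_simps power2_eq_square)
      finally have "eqv h (DT_Q h (scal (f * g) * ?w + scal (f * 4) * ?c) $ i) 0" by simp
      then show ?thesis unfolding 1 by (simp add: eqv_def)
    qed
  qed
qed

lemma cls_mem: "x \<in> cls h a \<longleftrightarrow> x - a \<in> mu_ideal h"
proof
  assume "x \<in> cls h a"
  then show "x - a \<in> mu_ideal h"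
    by (auto simp: cls_def a_r_coset_def r_coset_def falg_ring_def)
next
  assume "x - a \<in> mu_ideal h"
  then show "x \<in> cls h a"
    unfolding cls_def a_r_coset_def r_coset_def falg_ring_def
    by (auto intro!: bexI[of _ "x - a"])
qed

lemma cls_eq: "cls h a = cls h c \<longleftrightarrow> eqv h a c"
proof
  assume "cls h a = cls h c"
  moreover have "a \<in> cls h a" by (simp add: cls_mem mu_idealD(1))
  ultimately have "a \<in> cls h c" by simp
  then show "eqv h a c" by (simp add: cls_mem eqv_def)
next
  assume ac: "eqv h a c"
  have "eqv h x a \<longleftrightarrow> eqv h x c" for x
    using ac eqv_trans eqv_sym by blast
  then show "cls h a = cls h c"
    by (auto simp: set_eq_iff cls_mem eqv_def)
qed

lemma op_cls:
  assumes "h \<noteq> 0"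
  shows "the_elem ((\<lambda>a. cls h (DT_Q h a $ i)) ` cls h a) = cls h (DT_Q h a $ i)"
proof -
  have "cls h (DT_Q h x $ i) = cls h (DT_Q h a $ i)" if x: "x \<in> cls h a" for x
  proof -
    have "DT_Q h (x - a) $ i \<in> mu_ideal h"
      using x DT_Q_mu_ideal[OF assms] by (simp add: cls_mem)
    moreover have "DT_Q h x = DT_Q h (x - a) + DT_Q h a"
      by (simp flip: DT_Q_add)
    ultimately show ?thesis by (simp add: cls_eq eqv_def)
  qed
  moreover have "a \<in> cls h a" by (simp add: cls_mem mu_idealD(1))
  ultimately have "(\<lambda>a. cls h (DT_Q h a $ i)) ` cls h a = {cls h (DT_Q h a $ i)}"
    by blast
  then show ?thesis by simp
qed

lemma dtilde_cls: "h \<noteq> 0 \<Longrightarrow> dtilde h (cls h a) = cls h (DT_Q h a $ 1)"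
  by (simp add: dtilde_def op_cls)
lemma Q_op_cls: "h \<noteq> 0 \<Longrightarrow> Q_op h (cls h a) = cls h (DT_Q h a $ 2)"
  by (simp add: Q_op_def op_cls)

end

theory Submission
  imports Defs
begin

text \<open>
  Since \<open>b\<close> is a linear form with isotropic coefficient vector \<open>(-\<i>, -1, 0)\<close>, the derivatives act
  on its powers as in the commutative case: \<open>\<partial>\<^sub>x\<close> and \<open>\<partial>\<^sub>y\<close> of \<open>b\<^sup>k\<close> are \<open>-\<i>k b\<^sup>k\<^sup>-\<^sup>1\<close> and \<open>-k b\<^sup>k\<^sup>-\<^sup>1\<close>, and all
  quantum corrections cancel.  Hence \<open>(DT, Q)\<close> sends \<open>b\<^sup>k\<close> to \<open>(2/h b\<^sup>k, k b\<^sup>k)\<close>, and applying the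
  matrix that moves \<open>\<mu>\<^sup>p\<close> through gives both formulas.
\<close>

lemma cnst_ii_mult: "cnst \<i> * cnst \<i> = -1" "cnst \<i> * (cnst \<i> * f) = - f"
  by (simp_all add: cnst_ring flip: cnst_ring(2) mult.assoc)

text \<open>By linearity [d, b] = -i [d, x] - [d, y], so these are the relations
  \<open>LD_var\<close> for \<open>GX\<close> and \<open>GY\<close> combined with the coefficients
  of b. They are the recursion for the powers of b.\<close>

lemma LD_b_elt_mult:
  "LD (cnst h) DT (b_elt * a) = b_elt * LD (cnst h) DT a
     + scal (cnst h / 2) * (scal (cnst \<i>) * LD (cnst h) DX a + LD (cnst h) DY a)"
  "LD (cnst h) DX (b_elt * a) = b_elt * LD (cnst h) DX a
     - scal (cnst h / 2) * (scal (cnst \<i>) * LD (cnst h) DT a + LD (cnst h) DZ a)"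
  "LD (cnst h) DY (b_elt * a) = b_elt * LD (cnst h) DY a
     + scal (cnst h / 2) * (scal (cnst \<i>) * LD (cnst h) DZ a - LD (cnst h) DT a)"
  "LD (cnst h) DZ (b_elt * a) = b_elt * LD (cnst h) DZ a
     + scal (cnst h / 2) * (LD (cnst h) DX a - scal (cnst \<i>) * LD (cnst h) DY a)"
  by (simp_all add: b_elt_def LD_diff LD_uminus LD_scal LD_var scal_uminus distrib_left distrib_right
      left_diff_distrib right_diff_distrib mult.assoc)
    (simp_all add: mult.commute flip: mult.assoc scal_mult)

text \<open>Induction on k through the commutators with b. The corrections i \<open>DX\<close> +
  \<open>DY\<close> (for \<open>DT\<close>) and \<open>DX\<close> - i \<open>DY\<close> (for
  \<open>DZ\<close>) vanish on \<open>b_elt ^ k\<close>. For \<open>DX\<close> and \<open>DY\<close>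
  the \<open>DT\<close> term contributes h/2 * 2/h = 1, the new summand of the Leibniz rule. These
  are equalities in the free algebra, before passing to the quotient.\<close>

lemma LD_b_elt_power:
  assumes "h \<noteq> 0"
  shows "LD (cnst h) DT (b_elt ^ k) = scal (2 / cnst h) * b_elt ^ k"
    "LD (cnst h) DX (b_elt ^ k) = - (scal (cnst \<i> * of_nat k) * b_elt ^ (k - 1))"
    "LD (cnst h) DY (b_elt ^ k) = - (scal (of_nat k) * b_elt ^ (k - 1))"
    "LD (cnst h) DZ (b_elt ^ k) = 0"
proof (induction k)
  case 0
  have "LD (cnst h) d 1 = word_der (cnst h) d []" for d
    using LD_single[of "cnst h" d "[]" 1] by (simp add: single_Nil)
  then show "LD (cnst h) DT (b_elt ^ 0) = scal (2 / cnst h) * b_elt ^ 0"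
    "LD (cnst h) DX (b_elt ^ 0) = - (scal (cnst \<i> * of_nat 0) * b_elt ^ (0 - 1))"
    "LD (cnst h) DY (b_elt ^ 0) = - (scal (of_nat 0) * b_elt ^ (0 - 1))"
    "LD (cnst h) DZ (b_elt ^ 0) = 0" by simp_all
next
  case (Suc k)
  have c: "cnst h \<noteq> 0" using assms by simp
  have b: "b_elt * (scal c * a) = scal c * (b_elt * a)" for c a
    by (metis mult.assoc scal_comm)
  \<comment> \<open>At k = 0 the truncated exponent k - 1 is harmless, since the coefficient
    vanishes.\<close>
  have p: "scal (c * of_nat k) * (b_elt * b_elt ^ (k - Suc 0)) = scal (c * of_nat k) * b_elt ^ k" for c
    by (cases k) simp_all
  note R = LD_b_elt_mult Suc.IH b p[of 1, simplified] p
  show "LD (cnst h) DT (b_elt ^ Suc k) = scal (2 / cnst h) * b_elt ^ Suc k"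
  proof -
    have "scal (cnst \<i>) * (scal (cnst \<i> * of_nat k) * b_elt ^ (k - 1))
        = - (scal (of_nat k) * b_elt ^ (k - 1))"
      by (simp add: cnst_ii_mult scal_uminus flip: mult.assoc scal_mult)
    then show ?thesis by (simp add: R)
  qed
  show "LD (cnst h) DX (b_elt ^ Suc k) = - (scal (cnst \<i> * of_nat (Suc k)) * b_elt ^ (Suc k - 1))"
    using c by (simp add: R)
      (simp add: distrib_left distrib_right scal_add flip: scal_mult mult.assoc)
  show "LD (cnst h) DY (b_elt ^ Suc k) = - (scal (of_nat (Suc k)) * b_elt ^ (Suc k - 1))"
    using c by (simp add: R)
      (simp add: distrib_left distrib_right scal_add flip: scal_mult mult.assoc)
  show "LD (cnst h) DZ (b_elt ^ Suc k) = 0"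
    by (simp add: R flip: scal_mult mult.assoc)
qed

text \<open>Euler's identity: \<open>LQ\<close> multiplies by the generators on the left, so the
  factors -ik and -k of the derivatives reassemble k b in front of
  \<open>b_elt ^ (k - 1)\<close>.\<close>

lemma LQ_b_elt_power:
  assumes "h \<noteq> 0"
  shows "LQ (cnst h) (b_elt ^ k) = scal (of_nat k) * b_elt ^ k"
proof (cases k)
  case (Suc n)
  have b: "b_elt * a = - (scal (cnst \<i>) * (var GX * a)) - var GY * a" for a
    by (simp add: b_elt_def left_diff_distrib mult.assoc)
  have "LQ (cnst h) (b_elt ^ k)
      = - (scal (cnst \<i> * of_nat k) * (var GX * b_elt ^ n)) - scal (of_nat k) * (var GY * b_elt ^ n)"
    unfolding LQ_def LD_b_elt_power[OF assms] using Suc by (simp add: scal_left_comm del: of_nat_Suc)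
  also have "\<dots> = scal (of_nat k) * (b_elt * b_elt ^ n)"
    unfolding b by (simp add: right_diff_distrib scal_mult[of "of_nat k", symmetric]
        mult.commute[of "of_nat k" "cnst _"] flip: mult.assoc)
  finally have "LQ (cnst h) (b_elt ^ k) = scal (of_nat k) * (b_elt * b_elt ^ n)" .
  then show ?thesis using Suc by simp
qed (simp add: LQ_def LD_b_elt_power(2-4)[OF assms, of 0, simplified])

lemma b_elt_CC: "b_elt \<in> CC"
  unfolding b_elt_def by (intro CC_diff CC_mult CC_uminus CC_scal CC_var)

text \<open>Here the quotient enters: modulo \<open>mu_ideal h\<close>, Cas is a scalar in
  \<open>mu\<close>, so the entries of \<open>moved h f\<close> become the scalars
  \<open>mv h f i j\<close>, applied to the column (2/h, k).\<close>

lemma DT_Q_mu_b_elt: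
  assumes "h \<noteq> 0"
  shows "eqv h (DT_Q h (scal f * b_elt ^ k) $ i)
    (b_elt ^ k * scal (mv h f i 1 * (2 / cnst h) + mv h f i 2 * of_nat k))"
proof -
  have "eqv h (DT_Q h (scal f * b_elt ^ k) $ i)
      (scal (mv h f i 1) * (scal (2 / cnst h) * b_elt ^ k)
       + scal (mv h f i 2) * (scal (of_nat k) * b_elt ^ k))"
    using assms by (intro eqv_DT_Q CC_power b_elt_CC) (simp_all add: LD_b_elt_power LQ_b_elt_power eqv_refl)
  then show ?thesis
    unfolding scal_comm[of "b_elt ^ k"] by (simp only: scal_add scal_mult distrib_right mult.assoc)
qed

lemma cls_ring_hom: "cls h \<in> ring_hom falg_ring (u2_mu h)"
proof -
  interpret ideal "mu_ideal h" falg_ring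
    by (simp add: ideal_conv isideal_mu)
  show ?thesis
    using rcos_ring_hom by (simp add: u2_mu_def cls_def[abs_def])
qed

lemma cls_mult: "cls h a \<otimes>\<^bsub>u2_mu h\<^esub> cls h c = cls h (a * c)"
  using ring_hom_mult[OF cls_ring_hom[of h], of a c] by (simp add: falg_ring_def)

lemma cls_minus: "cls h a \<ominus>\<^bsub>u2_mu h\<^esub> cls h c = cls h (a - c)"
proof -
  interpret I: ideal "mu_ideal h" falg_ring
    by (simp add: ideal_conv isideal_mu)
  interpret R: ring "u2_mu h"
    unfolding u2_mu_def by (rule I.quotient_is_ring)
  interpret hom: ring_hom_ring falg_ring "u2_mu h" "cls h"
    by (intro ring_hom_ringI2 falg_ring_ring R.ring_axioms cls_ring_hom)
  have U: "x \<in> carrier falg_ring" for x by (simp add: falg_ring_def)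
  have add: "cls h x \<oplus>\<^bsub>u2_mu h\<^esub> cls h y = cls h (x + y)" for x y
    using hom.hom_add[of x y] by (simp add: falg_ring_def)
  \<comment> \<open>The ring difference is recovered from addition by cancelling
    \<open>cls h c\<close>.\<close>
  have "cls h (a - c) \<oplus>\<^bsub>u2_mu h\<^esub> cls h c = cls h a" by (simp add: add)
  then show ?thesis
    using hom.hom_closed[OF U] R.minus_eq R.a_assoc R.r_neg R.r_zero R.a_inv_closed by metis
qed

theorem proposition16:
  fixes h :: complex and k :: nat and p :: int
  assumes "h \<noteq> 0"
  shows "d_t h (cls h (scal (mu powi p) * b_elt ^ k)) =
           cls h (b_elt ^ k * scal
             (1 / cnst h * ((mu - cnst h) powi p + (mu + cnst h) powi p - 2 * mu powi p)
              - ((mu - cnst h) powi p - (mu + cnst h) powi p) / mu * of_nat (k + 1))) \<and>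
         Q_op h (cls h (scal (mu powi p) * b_elt ^ k)) =
           cls h (b_elt ^ k * scal
             (((mu - cnst h) powi p + (mu + cnst h) powi p) * (of_nat k / 2)
              + ((mu - cnst h) powi p - (mu + cnst h) powi p) / mu
                * (cnst h * of_nat (k + 1) / 2 - mu ^ 2 / (2 * cnst h))))"
proof
  let ?u = "(mu - cnst h) powi p" and ?v = "(mu + cnst h) powi p" and ?f = "mu powi p"
  let ?a = "scal ?f * b_elt ^ k"
  have c: "cnst h \<noteq> 0" using assms by simp
  have s: "subst_mu (- h) ?f = ?u" "subst_mu h ?f = ?v"
    by (simp_all add: subst_powi cnst_ring)
  \<comment> \<open>With u, v, f standing for the three powers, this is an identity of rational
    functions. The 1 in k + 1 comes from the diagonal entry, since ((mu - h) u + (mu + h) v) / (mu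
    h) = (u + v)/h - (u - v)/mu.\<close>
  have identity_DT: "(u * ((mu - cnst h) / (2 * mu)) + v * ((mu + cnst h) / (2 * mu))) * (2 / cnst h)
      + (v - u) / mu * of_nat k - 2 / cnst h * f
      = 1 / cnst h * (u + v - 2 * f) - (u - v) / mu * of_nat (k + 1)" for u v f
    using c mu_neq_cnst(3) by (simp add: field_simps)
  \<comment> \<open>The off-diagonal entry contributes 2 \<open>gam h\<close> / h = h/2 - mu^2/(2h)
    times (u - v)/mu; the diagonal one adds h k/2 to this factor.\<close>
  have identity_Q: "(u - v) * gam h / mu * (2 / cnst h)
      + (u * ((mu + cnst h) / (2 * mu)) + v * ((mu - cnst h) / (2 * mu))) * of_nat k
      = (u + v) * (of_nat k / 2)
        + (u - v) / mu * (cnst h * of_nat (k + 1) / 2 - mu ^ 2 / (2 * cnst h))" for u v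
    using c mu_neq_cnst(3) by (simp add: gam_def field_simps power2_eq_square)
  have "d_t h (cls h ?a) = cls h (DT_Q h ?a $ 1 - scal (cnst (2 / h)) * ?a)"
    by (simp add: d_t_def dtilde_cls[OF assms] cls_mult cls_minus)
  also have "\<dots> = cls h (b_elt ^ k * scal (mv h ?f 1 1 * (2 / cnst h) + mv h ?f 1 2 * of_nat k)
      - scal (cnst (2 / h)) * ?a)"
    unfolding cls_eq by (intro eqv_diff DT_Q_mu_b_elt assms eqv_refl)
  also have "scal (cnst (2 / h)) * ?a = b_elt ^ k * scal (2 / cnst h * ?f)"
    unfolding scal_comm[of "b_elt ^ k"] by (simp only: scal_mult cnst_divide cnst_num mult.assoc)
  also have "b_elt ^ k * scal (mv h ?f 1 1 * (2 / cnst h) + mv h ?f 1 2 * of_nat k) - \<dots>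
      = b_elt ^ k * scal (mv h ?f 1 1 * (2 / cnst h) + mv h ?f 1 2 * of_nat k - 2 / cnst h * ?f)"
    by (simp add: scal_diff right_diff_distrib)
  also have "mv h ?f 1 1 * (2 / cnst h) + mv h ?f 1 2 * of_nat k - 2 / cnst h * ?f
      = 1 / cnst h * (?u + ?v - 2 * ?f) - (?u - ?v) / mu * of_nat (k + 1)"
    unfolding mv_def s Let_def using identity_DT[of ?u ?v ?f] by simp
  finally show "d_t h (cls h ?a) = cls h (b_elt ^ k * scal
      (1 / cnst h * (?u + ?v - 2 * ?f) - (?u - ?v) / mu * of_nat (k + 1)))" .
  have "Q_op h (cls h ?a)
      = cls h (b_elt ^ k * scal (mv h ?f 2 1 * (2 / cnst h) + mv h ?f 2 2 * of_nat k))"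
    unfolding Q_op_cls[OF assms] cls_eq by (intro DT_Q_mu_b_elt assms)
  also have "mv h ?f 2 1 * (2 / cnst h) + mv h ?f 2 2 * of_nat k
      = (?u + ?v) * (of_nat k / 2)
        + (?u - ?v) / mu * (cnst h * of_nat (k + 1) / 2 - mu ^ 2 / (2 * cnst h))"
    unfolding mv_def s Let_def using identity_Q[of ?u ?v] by simp
  finally show "Q_op h (cls h ?a) = cls h (b_elt ^ k * scal ((?u + ?v) * (of_nat k / 2)
      + (?u - ?v) / mu * (cnst h * of_nat (k + 1) / 2 - mu ^ 2 / (2 * cnst h))))" .
qed

end
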